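(* Let $\bar x=(\bar x_1,\bar x_2,\dots)\in l_1$ and $\bar y=(\bar y_1,\bar y_2,\dots)\in P_{\mathbb B}(\bar x)$. The covering constant $\hat\alpha(P_{\mathbb B},\bar x,\bar y)$ has the following properties. (i) If $\|\bar x\|\ge1$ and $\sum_{n=1}^\infty\bar y_n\in\{1,-1\}$, then $\hat\alpha(P_{\mathbb B},\bar x,\bar y)=0$. (ii) If $\|\bar x\|\ge1$ and $\bar x\in K\cup(-K)$, then $\hat\alpha(P_{\mathbb B},\bar x,\bar y)=0$ for each $\bar y\in P_{\mathbb B}(\bar x)$. (iii) If $\|\bar x\|\ge2$, then there is $\bar y=(\bar y_1,\bar y_2,\dots)\in P_{\mathbb B}(\bar x)$ such that $\sum_{n=1}^\infty\bar y_n\in\{1,-1\}$ and $\hat\alpha(P_{\mathbb B},\bar x,\bar y)=0$. (iv) For any $\bar x\in\mathbb B^o$, for which $P_{\mathbb B}(\bar x)=\{\bar x\}$, we have $\hat\alpha(P_{\mathbb B},\bar x,\bar x)=1$.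
   Context: $(l_1,\|\cdot\|)$ is the real Banach space of absolutely summable real sequences with $\|x\|=\sum_{n=1}^\infty|x_n|$; its dual is $(l_\infty,\|\cdot\|_\infty)$ with pairing $\langle y^*,x\rangle=\sum_{n=1}^\infty x_ny_n^*$. $\mathbb B=\{x\in l_1:\|x\|\le1\}$, $\mathbb B^o$ its interior, and $\mathbb B(z,\eta)$ is the closed ball in $l_1$ of radius $\eta$ centered at $z$. $K=\{x\in l_1:x_n\ge0\ \forall n\ge1\}$, $-K=\{-x:x\in K\}$. The set-valued metric projection is $P_{\mathbb B}(x)=\{u\in\mathbb B:\|x-u\|\le\|x-v\|\ \forall v\in\mathbb B\}$. For a set-valued mapping $F:X\rightrightarrows Y$ between Banach spaces with graph $\mathrm{gph}F=\{(x,y):y\in F(x)\}$, and $(x,y)\in\mathrm{gph}F$, the Mordukhovich derivative $\widehat D^*F(x,y):Y^*\rightrightarrows X^*$ is $$\widehat D^*F(x,y)(y^* )=\Big\{x^*\in X^*:\ \limsup_{(u,v)\to(x,y),\ (u,v)\in\mathrm{gph}F}\frac{\langle x^*,u-x\rangle-\langle y^*,v-y\rangle}{\|u-x\|_X+\|v-y\|_Y}\le0\Big\},$$ the limsup being over $(u,v)\ne(x,y)$. The covering constant of $P_{\mathbb B}$ at $(\bar x,\bar y)$, $\bar y\in P_{\mathbb B}(\bar x)$, is $$\hat\alpha(P_{\mathbb B},\bar x,\bar y)=\sup_{\eta>0}\inf\big\{\|z^*\|_\infty:\ z^*\in\widehat D^*P_{\mathbb B}(x,y)(w^* ),\ x\in\mathbb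 B(\bar x,\eta),\ y\in P_{\mathbb B}(x)\cap\mathbb B(\bar y,\eta),\ w^*\in l_\infty,\ \|w^*\|_\infty=1\big\}.$$ *)

theory Defs
  imports "HOL-Analysis.Analysis"
begin

section \<open>The real Banach space of absolutely summable sequences\<close>

text \<open>Sequences are indexed by \<^typ>\<open>nat\<close>, that is from 0.\<close>

typedef l1 = "{x :: nat \<Rightarrow> real. summable (\<lambda>n. \<bar>x n\<bar>)}"
  morphisms l1_seq Abs_l1
  by (rule exI[of _ "\<lambda>_. 0"]) simp

setup_lifting type_definition_l1

lemma l1_eqI: "(\<And>n. l1_seq x n = l1_seq y n) \<Longrightarrow> x = y"
  by transfer auto

lemma summable_abs_l1_seq [simp]: "summable (\<lambda>n. \<bar>l1_seq x n\<bar>)"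
  by transfer simp

lemma summable_l1_seq [simp]: "summable (l1_seq x)"
  by (rule summable_rabs_cancel) simp

lemma summable_abs_add:
  fixes x y :: "nat \<Rightarrow> real"
  assumes "summable (\<lambda>n. \<bar>x n\<bar>)" "summable (\<lambda>n. \<bar>y n\<bar>)"
  shows "summable (\<lambda>n. \<bar>x n + y n\<bar>)"
  by (rule summable_comparison_test'[OF summable_add[OF assms]]) (simp add: abs_triangle_ineq)

instantiation l1 :: real_vector
begin

lift_definition zero_l1 :: l1 is "\<lambda>_. 0" by simp
lift_definition plus_l1 :: "l1 \<Rightarrow> l1 \<Rightarrow> l1" is "\<lambda>x y n. x n + y n"
  by (simp add: summable_abs_add)
lift_definition uminus_l1 :: "l1 \<Rightarrow> l1" is "\<lambda>x n. - x n" by simp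
lift_definition scaleR_l1 :: "real \<Rightarrow> l1 \<Rightarrow> l1" is "\<lambda>r x n. r * x n"
  by (simp add: abs_mult summable_mult)
definition minus_l1 :: "l1 \<Rightarrow> l1 \<Rightarrow> l1" where "x - y = x + - (y :: l1)"

lemma l1_seq_simps [simp]:
  "l1_seq 0 n = 0"
  "l1_seq (x + y) n = l1_seq x n + l1_seq y n"
  "l1_seq (- x) n = - l1_seq x n"
  "l1_seq (x - y) n = l1_seq x n - l1_seq y n"
  "l1_seq (r *\<^sub>R x) n = r * l1_seq x n"
  by (simp_all add: minus_l1_def zero_l1.rep_eq plus_l1.rep_eq uminus_l1.rep_eq scaleR_l1.rep_eq)

instance
  by standard (rule l1_eqI, simp add: algebra_simps)+

end

instantiation l1 :: real_normed_vector
begin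

definition norm_l1 :: "l1 \<Rightarrow> real" where "norm x = (\<Sum>n. \<bar>l1_seq x n\<bar>)"
definition dist_l1 :: "l1 \<Rightarrow> l1 \<Rightarrow> real" where "dist x y = norm (x - y)" for x y :: l1
definition sgn_l1 :: "l1 \<Rightarrow> l1" where "sgn x = x /\<^sub>R norm x" for x :: l1
definition uniformity_l1 :: "(l1 \<times> l1) filter"
  where "uniformity_l1 = (INF e\<in>{0 <..}. principal {(x, y). dist x y < e})"
definition open_l1 :: "l1 set \<Rightarrow> bool"
  where "open_l1 S = (\<forall>x\<in>S. \<forall>\<^sub>F (x', y) in uniformity. x' = x \<longrightarrow> y \<in> S)"

instance
proof
  fix x y :: l1 and r :: real
  show "norm x = 0 \<longleftrightarrow> x = 0"
  proof
    assume "norm x = 0"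
    then have "\<forall>n. \<bar>l1_seq x n\<bar> = 0"
      unfolding norm_l1_def by (subst (asm) suminf_eq_zero_iff) simp_all
    then show "x = 0" by (intro l1_eqI) simp
  qed (simp add: norm_l1_def)
  have "norm (x + y) \<le> (\<Sum>n. \<bar>l1_seq x n\<bar> + \<bar>l1_seq y n\<bar>)"
    unfolding norm_l1_def
    by (intro suminf_le summable_add summable_abs_l1_seq) (simp add: abs_triangle_ineq)
  also have "\<dots> = norm x + norm y"
    unfolding norm_l1_def by (rule suminf_add[symmetric]) (rule summable_abs_l1_seq)+
  finally show "norm (x + y) \<le> norm x + norm y" .
  show "norm (r *\<^sub>R x) = \<bar>r\<bar> * norm x"
    unfolding norm_l1_def l1_seq_simps abs_mult by (rule suminf_mult) (rule summable_abs_l1_seq)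
qed (rule dist_l1_def sgn_l1_def open_l1_def uniformity_l1_def)+

end

lemma abs_l1_seq_le_norm: "\<bar>l1_seq x n\<bar> \<le> norm x"
  unfolding norm_l1_def using sum_le_suminf[of "\<lambda>n. \<bar>l1_seq x n\<bar>" "{n}"] by simp

lemma sum_abs_l1_seq_le_norm: "(\<Sum>n<p. \<bar>l1_seq x n\<bar>) \<le> norm x"
  unfolding norm_l1_def by (rule sum_le_suminf) auto

instance l1 :: banach
proof
  fix X :: "nat \<Rightarrow> l1"
  assume X: "Cauchy X"
  have "\<exists>l. (\<lambda>k. l1_seq (X k) n) \<longlonglongrightarrow> l" for n
  proof -
    have "Cauchy (\<lambda>k. l1_seq (X k) n)"
    proof (rule CauchyI)
      fix e :: real assume "0 < e"
      with X obtain M where "\<forall>m\<ge>M. \<forall>k\<ge>M. norm (X m - X k) < e"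
        unfolding Cauchy_iff by blast
      then show "\<exists>M. \<forall>m\<ge>M. \<forall>k\<ge>M. norm (l1_seq (X m) n - l1_seq (X k) n) < e"
        by (metis abs_l1_seq_le_norm l1_seq_simps(4) le_less_trans real_norm_def)
    qed
    then show ?thesis by (simp add: Cauchy_convergent_iff convergent_def)
  qed
  then obtain f where f: "\<And>n. (\<lambda>k. l1_seq (X k) n) \<longlonglongrightarrow> f n" by metis
  have tail: "summable (\<lambda>n. \<bar>l1_seq (X m) n - f n\<bar>) \<and> (\<Sum>n. \<bar>l1_seq (X m) n - f n\<bar>) \<le> e"
    if M: "\<forall>m\<ge>M. \<forall>k\<ge>M. norm (X m - X k) < e" and m: "m \<ge> M" for M m e
  proof -
    have le: "(\<Sum>n<p. \<bar>l1_seq (X m) n - f n\<bar>) \<le> e" for p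
    proof (rule tendsto_upperbound)
      show "(\<lambda>k. \<Sum>n<p. \<bar>l1_seq (X m) n - l1_seq (X k) n\<bar>)
              \<longlonglongrightarrow> (\<Sum>n<p. \<bar>l1_seq (X m) n - f n\<bar>)"
        by (intro tendsto_intros f)
      have "(\<Sum>n<p. \<bar>l1_seq (X m) n - l1_seq (X k) n\<bar>) \<le> e" if "k \<ge> M" for k
        using sum_abs_l1_seq_le_norm[of "X m - X k" p] M m that by fastforce
      then show "\<forall>\<^sub>F k in sequentially. (\<Sum>n<p. \<bar>l1_seq (X m) n - l1_seq (X k) n\<bar>) \<le> e"
        unfolding eventually_sequentially by blast
    qed simp
    have s: "summable (\<lambda>n. \<bar>l1_seq (X m) n - f n\<bar>)"
      by (rule summableI_nonneg_bounded[OF _ le]) simp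
    with le show ?thesis by (auto intro: suminf_le_const)
  qed
  obtain M where M: "\<forall>m\<ge>M. \<forall>k\<ge>M. norm (X m - X k) < 1"
    using X unfolding Cauchy_iff by (meson zero_less_one)
  have "summable (\<lambda>n. \<bar>l1_seq (X M) n\<bar> + \<bar>l1_seq (X M) n - f n\<bar>)"
    using tail[OF M] by (intro summable_add) auto
  then have "summable (\<lambda>n. \<bar>f n\<bar>)"
    by (rule summable_comparison_test'[of _ 0]) (use abs_triangle_ineq3 in \<open>simp add: abs_if\<close>)
  then have F: "l1_seq (Abs_l1 f) = f" by (simp add: Abs_l1_inverse)
  have "X \<longlonglongrightarrow> Abs_l1 f"
  proof (rule LIMSEQ_I)
    fix e :: real assume "0 < e"
    then have "0 < e / 2" by simp
    then obtain M where M: "\<forall>m\<ge>M. \<forall>k\<ge>M. norm (X m - X k) < e / 2"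
      using X unfolding Cauchy_iff by blast
    have "norm (X m - Abs_l1 f) \<le> e / 2" if "m \<ge> M" for m
      using tail[OF M that] by (simp add: norm_l1_def F)
    then have "norm (X m - Abs_l1 f) < e" if "m \<ge> M" for m
      using that \<open>0 < e\<close> by fastforce
    then show "\<exists>M. \<forall>m\<ge>M. norm (X m - Abs_l1 f) < e" by blast
  qed
  then show "convergent X" by (rule convergentI)
qed

definition l1_cone :: "l1 set"
  where "l1_cone = {x. \<forall>n. 0 \<le> l1_seq x n}"


section \<open>The dual of the sequence space\<close>

text \<open>
  Every function on the discrete space \<^typ>\<open>nat\<close> is continuous, so the bounded continuous
  functions on it, with their supremum norm, are exactly the bounded sequences.
\<close>

type_synonym linf = "nat \<Rightarrow>\<^sub>C real"

lemma norm_linf_eq: "norm (y :: linf) = (SUP n. \<bar>apply_bcontfun y n\<bar>)"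
  by (simp add: norm_bcontfun_def dist_bcontfun.rep_eq dist_real_def)

lemma abs_linf_le_norm: "\<bar>apply_bcontfun (y :: linf) n\<bar> \<le> norm y"
  using norm_bounded[of y n] by simp

lemma summable_abs_l1_linf: "summable (\<lambda>n. \<bar>l1_seq x n * apply_bcontfun (y :: linf) n\<bar>)"
proof -
  have "summable (\<lambda>n. \<bar>l1_seq x n\<bar> * norm y)" by (intro summable_mult2) simp
  then show ?thesis
    by (rule summable_comparison_test')
      (simp add: abs_mult mult_left_mono abs_linf_le_norm)
qed

lemma abs_l1_linf_le: "\<bar>\<Sum>n. l1_seq x n * apply_bcontfun (y :: linf) n\<bar> \<le> norm x * norm y"
proof -
  have "\<bar>\<Sum>n. l1_seq x n * apply_bcontfun y n\<bar> \<le> (\<Sum>n. \<bar>l1_seq x n * apply_bcontfun y n\<bar>)"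
    by (rule summable_rabs[OF summable_abs_l1_linf])
  also have "\<dots> \<le> (\<Sum>n. \<bar>l1_seq x n\<bar> * norm y)"
    by (intro suminf_le summable_abs_l1_linf summable_mult2 summable_abs_l1_seq)
      (simp add: abs_mult mult_left_mono abs_linf_le_norm)
  also have "\<dots> = norm x * norm y" by (simp add: norm_l1_def suminf_mult2)
  finally show ?thesis .
qed

definition linf_functional :: "linf \<Rightarrow> (l1 \<Rightarrow>\<^sub>L real)"
  where "linf_functional y = Blinfun (\<lambda>x. \<Sum>n. l1_seq x n * apply_bcontfun y n)"

lemma linf_functional_apply:
  "blinfun_apply (linf_functional y) x = (\<Sum>n. l1_seq x n * apply_bcontfun y n)"
proof -
  have s: "summable (\<lambda>n. l1_seq x n * apply_bcontfun y n)" for x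
    by (rule summable_rabs_cancel[OF summable_abs_l1_linf])
  have "bounded_linear (\<lambda>x. \<Sum>n. l1_seq x n * apply_bcontfun y n)"
  proof (rule bounded_linear_intro)
    fix u v :: l1 and r :: real
    show "(\<Sum>n. l1_seq (u + v) n * apply_bcontfun y n) =
      (\<Sum>n. l1_seq u n * apply_bcontfun y n) + (\<Sum>n. l1_seq v n * apply_bcontfun y n)"
      by (simp add: suminf_add[OF s s] distrib_right)
    show "(\<Sum>n. l1_seq (r *\<^sub>R u) n * apply_bcontfun y n) =
      r *\<^sub>R (\<Sum>n. l1_seq u n * apply_bcontfun y n)"
      by (simp add: suminf_mult[OF s] mult.assoc)
    show "norm (\<Sum>n. l1_seq u n * apply_bcontfun y n) \<le> norm u * norm y"
      using abs_l1_linf_le by simp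
  qed
  then show ?thesis by (simp add: linf_functional_def bounded_linear_Blinfun_apply)
qed

lift_definition l1_unit :: "nat \<Rightarrow> l1" is "\<lambda>k n. if n = k then 1 else 0"
  by (auto intro: summable_finite[of "{_}"])

lemma suminf_l1_unit: "(\<Sum>n. l1_seq (l1_unit k) n * g n) = g k"
  by (subst suminf_finite[of "{k}"]) (auto simp: l1_unit.rep_eq)

lemma norm_l1_unit: "norm (l1_unit k) = 1"
  unfolding norm_l1_def by (subst suminf_finite[of "{k}"]) (auto simp: l1_unit.rep_eq)

lemma linf_functional_l1_unit [simp]: "linf_functional y (l1_unit k) = apply_bcontfun y k"
  by (simp add: linf_functional_apply suminf_l1_unit)

lemma norm_linf_functional: "norm (linf_functional y) = norm y"
proof (rule antisym)
  show "norm (linf_functional y) \<le> norm y"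
    by (rule norm_blinfun_bound)
      (use abs_l1_linf_le in \<open>auto simp: linf_functional_apply mult.commute\<close>)
  show "norm y \<le> norm (linf_functional y)"
  proof (rule norm_bound)
    show "norm (apply_bcontfun y k) \<le> norm (linf_functional y)" for k
      using norm_blinfun[of "linf_functional y" "l1_unit k"] by (simp add: norm_l1_unit)
  qed
qed

lemma l1_unit_sums: "(\<lambda>n. l1_seq x n *\<^sub>R l1_unit n) sums x"
  unfolding sums_def
proof (rule LIMSEQ_I)
  fix e :: real assume "0 < e"
  have seq: "l1_seq (\<Sum>n<p. l1_seq x n *\<^sub>R l1_unit n) m = (if m < p then l1_seq x m else 0)" for p m
    by (induction p) (auto simp: l1_unit.rep_eq less_Suc_eq)
  obtain N where N: "\<And>p. p \<ge> N \<Longrightarrow> \<bar>\<Sum>n. \<bar>l1_seq x (n + p)\<bar>\<bar> < e"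
    using suminf_exist_split[OF \<open>0 < e\<close> summable_abs_l1_seq[of x]] by (simp only: real_norm_def) blast
  have "norm ((\<Sum>n<p. l1_seq x n *\<^sub>R l1_unit n) - x) < e" if "p \<ge> N" for p
  proof -
    have "norm ((\<Sum>n<p. l1_seq x n *\<^sub>R l1_unit n) - x)
        = (\<Sum>n. \<bar>l1_seq ((\<Sum>n<p. l1_seq x n *\<^sub>R l1_unit n) - x) (n + p)\<bar>)
          + (\<Sum>n<p. \<bar>l1_seq ((\<Sum>n<p. l1_seq x n *\<^sub>R l1_unit n) - x) n\<bar>)"
      unfolding norm_l1_def by (rule suminf_split_initial_segment) (rule summable_abs_l1_seq)
    also have "\<dots> = (\<Sum>n. \<bar>l1_seq x (n + p)\<bar>)"
      unfolding l1_seq_simps(4) seq by simp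
    also have "\<dots> < e" using N[OF that] by linarith
    finally show ?thesis .
  qed
  then show "\<exists>N. \<forall>p\<ge>N. norm ((\<Sum>n<p. l1_seq x n *\<^sub>R l1_unit n) - x) < e"
    by blast
qed

text \<open>
  The pairing identifies the bounded sequences isometrically (see \<open>norm_linf_functional\<close>) with
  the whole of the dual space.
\<close>

lemma bij_linf_functional: "bij linf_functional"
proof (rule bijI)
  show "inj linf_functional"
    by (rule injI, rule bcontfun_eqI) (metis linf_functional_l1_unit)
  show "surj linf_functional"
  proof (rule surjI)
    fix f :: "l1 \<Rightarrow>\<^sub>L real"
    have "(\<lambda>n. f (l1_unit n)) \<in> bcontfun"
    proof -
      have "\<bar>f (l1_unit n)\<bar> \<le> norm f" for n
        using norm_blinfun[of f "l1_unit n"] by (simp add: norm_l1_unit)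
      then show ?thesis by (auto simp: bcontfun_def bounded_iff)
    qed
    then have *: "apply_bcontfun (Bcontfun (\<lambda>n. f (l1_unit n))) n = f (l1_unit n)" for n
      by (simp add: Bcontfun_inverse)
    show "linf_functional (Bcontfun (\<lambda>n. f (l1_unit n))) = f"
    proof (rule blinfun_eqI)
      fix x
      have "(\<lambda>n. f (l1_seq x n *\<^sub>R l1_unit n)) sums f x"
        by (rule bounded_linear.sums[OF blinfun.bounded_linear_right l1_unit_sums])
      then show "linf_functional (Bcontfun (\<lambda>n. f (l1_unit n))) x = f x"
        by (simp only: linf_functional_apply * blinfun.scaleR_right sums_iff real_scaleR_def)
    qed
  qed
qed


section \<open>Metric projection, Mordukhovich derivative, covering constant\<close>

definition metric_projection :: "'a::real_normed_vector set \<Rightarrow> 'a \<Rightarrow> 'a set"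
  where "metric_projection C x = {u \<in> C. \<forall>v\<in>C. norm (x - u) \<le> norm (x - v)}"

definition gph :: "('a \<Rightarrow> 'b set) \<Rightarrow> ('a \<times> 'b) set"
  where "gph F = {(x, y). y \<in> F x}"

text \<open>
  The filter \<open>at (x, y) within gph F\<close> leaves out the point \<open>(x, y)\<close> itself; its topology, the
  product topology, is the one induced by the norm sum in the denominator.
\<close>

definition mordukhovich_derivative ::
    "('a::banach \<Rightarrow> 'b::banach set) \<Rightarrow> 'a \<Rightarrow> 'b \<Rightarrow> ('b \<Rightarrow>\<^sub>L real) \<Rightarrow> ('a \<Rightarrow>\<^sub>L real) set"
  where "mordukhovich_derivative F x y ystar =
    {xstar. Limsup (at (x, y) within gph F)
      (\<lambda>(u, v). ereal ((blinfun_apply xstar (u - x) - blinfun_apply ystar (v - y))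
                        / (norm (u - x) + norm (v - y)))) \<le> 0}"

text \<open>
  Extended reals give the infimum of the empty set and unbounded suprema their usual values.
\<close>

definition covering_constant :: "(l1 \<Rightarrow> l1 set) \<Rightarrow> l1 \<Rightarrow> l1 \<Rightarrow> ereal"
  where "covering_constant F xbar ybar =
    (SUP \<eta>\<in>{0 :: real <..}.
      Inf {ereal (norm zstar) | (zstar :: linf) (wstar :: linf) x y.
        linf_functional zstar \<in> mordukhovich_derivative F x y (linf_functional wstar)
        \<and> x \<in> cball xbar \<eta> \<and> y \<in> F x \<inter> cball ybar \<eta> \<and> norm wstar = 1})"

abbreviation unit_ball :: "l1 set"
  where "unit_ball \<equiv> cball 0 1"

abbreviation P_ball :: "l1 \<Rightarrow> l1 set"
  where "P_ball \<equiv> metric_projection unit_ball"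

end

theory Submission
  imports Defs
begin

text \<open>
  If the entries of \<open>y \<in> P(x)\<close> add up to \<open>1\<close>, then \<open>y\<close> maximises the functional given by the constant
  sequence \<open>1\<close> over the unit ball, which contains the range of \<open>P\<close>; so \<open>0\<close> is a Mordukhovich
  derivative in the direction of the constant sequence \<open>-1\<close>, and the covering constant vanishes. Every
  projection of a point of the cone has this property. If \<open>norm x \<ge> 2\<close>, then \<open>x\<close> or \<open>- x\<close> has a
  positive part of norm at least \<open>1\<close>, and normalising that part gives such a projection.
  In the open unit ball \<open>P\<close> is the identity, so its derivative is the identity as well.
\<close>

section \<open>Projection onto the unit ball of a normed space\<close>

lemma metric_projection_mem: "x \<in> C \<Longrightarrow> metric_projection C x = {x}"
  by (force simp: metric_projection_def)

text \<open>The radial point \<open>x /\<^sub>R norm x\<close> is a competitor in the ball, at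
  distance \<open>norm x - 1\<close> from \<open>x\<close>.\<close>

lemma norm_metric_projection_unit_ball_le:
  assumes y: "y \<in> metric_projection (cball 0 1) x" and x: "norm x \<ge> 1"
  shows "norm (x - y) \<le> norm x - 1"
proof -
  have "x \<noteq> 0" using x by auto
  then have "x /\<^sub>R norm x \<in> cball 0 1" by simp
  then have "norm (x - y) \<le> norm (x - x /\<^sub>R norm x)"
    using y by (auto simp: metric_projection_def)
  also have "x - x /\<^sub>R norm x = ((norm x - 1) / norm x) *\<^sub>R x"
    using \<open>x \<noteq> 0\<close> by (simp add: diff_divide_distrib scaleR_left_diff_distrib inverse_eq_divide)
  also have "norm \<dots> = norm x - 1"
    using x by (subst norm_scaleR) auto
  finally show ?thesis .
qed

text \<open>By the triangle inequality no point of the ball is closer to \<open>x\<close> than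
  \<open>norm x - 1\<close>.\<close>

lemma metric_projection_unit_ballI:
  assumes "norm y \<le> 1" "norm (x - y) \<le> norm x - 1"
  shows "y \<in> metric_projection (cball 0 1) x"
  unfolding metric_projection_def
proof (intro CollectI conjI ballI)
  fix v :: 'a assume "v \<in> cball 0 1"
  then show "norm (x - y) \<le> norm (x - v)"
    using assms norm_triangle_ineq2[of x v] by simp
qed (use assms in simp)

lemma interior_unit_ball_norm_less:
  fixes x :: "'a::real_normed_vector"
  assumes "x \<in> interior (cball 0 1)"
  shows "norm x < 1"
proof (cases "x = 0")
  case False
  obtain e where e: "e > 0" "cball x e \<subseteq> cball 0 1"
    using assms by (meson mem_interior_cball)
  \<comment> \<open>Moving outwards along the ray through \<open>x\<close> by length
    \<open>e\<close> stays in the ball, so \<open>norm x + e\<close> is at most 1.\<close>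
  have "x + (e / norm x) *\<^sub>R x \<in> cball x e"
    using e False by (simp add: dist_norm)
  then have "norm (x + (e / norm x) *\<^sub>R x) \<le> 1"
    using e by (metis mem_cball_0 subsetD)
  also have "x + (e / norm x) *\<^sub>R x = (1 + e / norm x) *\<^sub>R x"
    by (simp add: scaleR_left_distrib)
  also have "norm \<dots> = norm x + e"
    using e False by (subst norm_scaleR) (simp add: abs_of_pos add_pos_pos field_simps)
  finally show ?thesis using e by simp
qed simp

section \<open>Coordinate sums, signs and projections of sequences\<close>

lemma suminf_l1_le_norm: "(\<Sum>n. l1_seq x n) \<le> norm x"
  unfolding norm_l1_def by (intro suminf_le) auto

lemma suminf_l1_uminus: "(\<Sum>n. l1_seq (- x) n) = - (\<Sum>n. l1_seq x n)"
  using suminf_minus[OF summable_l1_seq[of x]] by simp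

lemma suminf_l1_diff: "(\<Sum>n. l1_seq (x - y) n) = (\<Sum>n. l1_seq x n) - (\<Sum>n. l1_seq y n)"
  using suminf_diff[OF summable_l1_seq[of x] summable_l1_seq[of y]] by simp

lemma norm_l1_cone: "x \<in> l1_cone \<Longrightarrow> norm x = (\<Sum>n. l1_seq x n)"
  by (simp add: norm_l1_def l1_cone_def)

lemma norm_l1_add_same_sign:
  assumes "\<And>n. l1_seq x n * l1_seq y n \<ge> 0"
  shows "norm (x + y) = norm x + norm y"
proof -
  have "\<bar>l1_seq x n + l1_seq y n\<bar> = \<bar>l1_seq x n\<bar> + \<bar>l1_seq y n\<bar>" for n
    using assms[of n] by (auto simp: zero_le_mult_iff)
  then show ?thesis by (simp add: norm_l1_def suminf_add)
qed

text \<open>Norm and ball are symmetric. This reduces the negative cone to the cone, and negative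
  parts to positive parts.\<close>

lemma P_ball_uminus: "- y \<in> P_ball (- x) \<longleftrightarrow> y \<in> P_ball x"
proof -
  have *: "- y \<in> P_ball (- x)" if "y \<in> P_ball x" for x y
    unfolding metric_projection_def
  proof (intro CollectI conjI ballI)
    fix v :: l1 assume "v \<in> unit_ball"
    then have "norm (x - y) \<le> norm (x - (- v))"
      using that unfolding metric_projection_def by (auto simp del: diff_minus_eq_add)
    then show "norm (- x - - y) \<le> norm (- x - v)"
      by (metis minus_diff_eq minus_diff_minus norm_minus_commute norm_minus_cancel minus_minus)
  qed (use that in \<open>simp add: metric_projection_def\<close>)
  show ?thesis using *[of y x] *[of "- y" "- x"] by auto
qed

lemma suminf_P_ball_cone:
  assumes "x \<in> l1_cone" "norm x \<ge> 1" and y: "y \<in> P_ball x"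
  shows "(\<Sum>n. l1_seq y n) = 1"
proof -
  \<comment> \<open>On the cone the norm of \<open>x\<close> is its coordinate sum, so the bound on
    \<open>norm (x - y)\<close> forces the sum of \<open>y\<close> up to at least 1.\<close>
  have "(\<Sum>n. l1_seq x n) - (\<Sum>n. l1_seq y n) \<le> (\<Sum>n. l1_seq x n) - 1"
    using suminf_l1_le_norm[of "x - y"] norm_metric_projection_unit_ball_le[OF y assms(2)]
    unfolding suminf_l1_diff norm_l1_cone[OF assms(1)] by linarith
  moreover have "(\<Sum>n. l1_seq y n) \<le> 1"
    using suminf_l1_le_norm[of y] y by (simp add: metric_projection_def)
  ultimately show ?thesis by simp
qed

lift_definition l1_pos_part :: "l1 \<Rightarrow> l1" is "\<lambda>x n. max (x n) 0"
proof -
  fix x :: "nat \<Rightarrow> real" assume "summable (\<lambda>n. \<bar>x n\<bar>)"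
  then show "summable (\<lambda>n. \<bar>max (x n) 0\<bar>)"
    by (rule summable_comparison_test') auto
qed

lemma norm_l1_pos_part_add: "norm (l1_pos_part x) + norm (l1_pos_part (- x)) = norm x"
proof -
  have "\<bar>l1_seq (l1_pos_part x) n\<bar> + \<bar>l1_seq (l1_pos_part (- x)) n\<bar> = \<bar>l1_seq x n\<bar>" for n
    by (simp add: l1_pos_part.rep_eq)
  then show ?thesis
    unfolding norm_l1_def
    by (subst suminf_add[OF summable_abs_l1_seq summable_abs_l1_seq]) simp
qed

lemma P_ball_suminf_1:
  assumes "norm (l1_pos_part x) \<ge> 1"
  obtains y where "y \<in> P_ball x" "(\<Sum>n. l1_seq y n) = 1"
proof
  define p where "p = l1_pos_part x"
  define y where "y = p /\<^sub>R norm p"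
  have p: "norm p \<ge> 1" "p \<in> l1_cone"
    using assms by (simp_all add: p_def l1_cone_def l1_pos_part.rep_eq)
  have "p \<noteq> 0" using p by auto
  then have ny: "norm y = 1" "y \<in> l1_cone"
    using p by (auto simp: y_def l1_cone_def)
  show "(\<Sum>n. l1_seq y n) = 1"
    using ny norm_l1_cone by metis
  \<comment> \<open>Where \<open>x\<close> is positive, \<open>y\<close> is \<open>x\<close> scaled
    by a factor in (0, 1]; elsewhere \<open>y\<close> is 0. Hence \<open>y\<close> and
    \<open>x - y\<close> never have opposite signs, and the norms add up with
    \<open>norm y = 1\<close>.\<close>
  have "l1_seq y n * l1_seq (x - y) n \<ge> 0" for n
  proof (cases "l1_seq x n > 0")
    case True
    then have "l1_seq y n = inverse (norm p) * l1_seq x n"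
      by (simp add: y_def p_def l1_pos_part.rep_eq)
    moreover have "inverse (norm p) * l1_seq x n \<le> 1 * l1_seq x n"
      using p True by (intro mult_right_mono inverse_le_1_iff[THEN iffD2]) auto
    ultimately show ?thesis using True by simp
  qed (simp add: y_def p_def l1_pos_part.rep_eq)
  then have "norm x = norm y + norm (x - y)"
    using norm_l1_add_same_sign[of y "x - y"] by simp
  then show "y \<in> P_ball x"
    using ny by (intro metric_projection_unit_ballI) auto
qed

section \<open>Mordukhovich derivatives\<close>

text \<open>Near \<open>(x, x)\<close> the graph is the diagonal, where the quotient is
  \<open>(h - g) (u - x)\<close> over \<open>2 * norm (u - x)\<close>. Its upper limit is
  nonpositive only if the linear functional \<open>h - g\<close> is nonpositive in every direction,
  that is, zero.\<close>

lemma mordukhovich_derivative_eventually_id: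
  fixes F :: "'a::banach \<Rightarrow> 'a set"
  assumes F: "\<forall>\<^sub>F u in nhds x. F u = {u}"
  shows "mordukhovich_derivative F x x g = {g}"
proof (rule set_eqI)
  have ev: "\<forall>\<^sub>F (u, v) in at (x, x) within gph F. v = u"
  proof -
    have "filterlim fst (nhds x) (at (x, x) within gph F)"
      using tendsto_fst[OF tendsto_ident_at[of "(x, x)" "gph F"]] by simp
    from eventually_compose_filterlim[OF F this]
    have "\<forall>\<^sub>F p in at (x, x) within gph F. F (fst p) = {fst p}" .
    moreover have "\<forall>\<^sub>F p in at (x, x) within gph F. p \<in> gph F"
      by (simp add: eventually_at_filter)
    ultimately show ?thesis
      by eventually_elim (auto simp: gph_def)
  qed
  fix h
  show "h \<in> mordukhovich_derivative F x x g \<longleftrightarrow> h \<in> {g}"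
  proof
    assume h: "h \<in> mordukhovich_derivative F x x g"
    have le: "blinfun_apply (h - g) d \<le> 0" for d
    proof (rule ccontr)
      assume pos: "\<not> blinfun_apply (h - g) d \<le> 0"
      then have d: "d \<noteq> 0" by auto
      \<comment> \<open>This is the constant value of the quotient along the ray
        \<open>x + t *\<^sub>R d\<close> with \<open>t > 0\<close>. The upper limit is at most 0, so
        the quotient would eventually have to be smaller than its own value
        \<open>c\<close>.\<close>
      define c where "c = blinfun_apply (h - g) d / (2 * norm d)"
      have "c > 0" using pos d by (simp add: c_def)
      then have less: "\<forall>\<^sub>F (u, v) in at (x, x) within gph F.
          (blinfun_apply h (u - x) - blinfun_apply g (v - x)) / (norm (u - x) + norm (v - x)) < c"
        using h unfolding mordukhovich_derivative_def mem_Collect_eq Limsup_le_iff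
        by (auto dest!: spec[of _ "ereal c"] simp: case_prod_beta' zero_ereal_def)
      have lim: "((\<lambda>t. x + t *\<^sub>R d) \<longlongrightarrow> x) (at_right 0)"
        by (auto intro!: tendsto_eq_intros)
      \<comment> \<open>The diagonal ray is an admissible approach: it lies in the graph for small
        \<open>t\<close>, and \<open>t > 0\<close> with \<open>d \<noteq> 0\<close> keeps it off the
        base point.\<close>
      have "filterlim (\<lambda>t. (x + t *\<^sub>R d, x + t *\<^sub>R d)) (at (x, x) within gph F) (at_right 0)"
        unfolding filterlim_at
      proof
        show "((\<lambda>t. (x + t *\<^sub>R d, x + t *\<^sub>R d)) \<longlongrightarrow> (x, x)) (at_right 0)"
          by (intro tendsto_Pair lim)
        have "\<forall>\<^sub>F t::real in at_right 0. t > 0"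
          by (rule eventually_at_right_less)
        with eventually_compose_filterlim[OF F lim]
        show "\<forall>\<^sub>F t in at_right 0. (x + t *\<^sub>R d, x + t *\<^sub>R d) \<in> gph F
            \<and> (x + t *\<^sub>R d, x + t *\<^sub>R d) \<noteq> (x, x)"
          by eventually_elim (use d in \<open>auto simp: gph_def\<close>)
      qed
      from eventually_compose_filterlim[OF less this]
      have "\<forall>\<^sub>F t::real in at_right 0. t * blinfun_apply (h - g) d / (2 * (\<bar>t\<bar> * norm d)) < c"
        by (simp add: blinfun.scaleR_right blinfun.diff_left algebra_simps)
      moreover have "\<forall>\<^sub>F t::real in at_right 0. t > 0"
        by (rule eventually_at_right_less)
      ultimately have "\<forall>\<^sub>F t::real in at_right 0. False"
        by eventually_elim (simp add: c_def)
      then show False by simp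
    qed
    have "blinfun_apply (h - g) d = 0" for d
      using le[of d] le[of "- d"] by (simp add: blinfun.minus_right)
    then show "h \<in> {g}"
      by (simp add: blinfun.diff_left blinfun_eqI)
  next
    assume "h \<in> {g}"
    then have "h = g" by simp
    show "h \<in> mordukhovich_derivative F x x g"
      unfolding mordukhovich_derivative_def mem_Collect_eq \<open>h = g\<close>
      by (intro Limsup_bounded eventually_mono[OF ev]) auto
  qed
qed

text \<open>Since \<open>y\<close> minimises \<open>g\<close> over the range of \<open>F\<close>,
  the numerator \<open>- g (v - y)\<close> is nonpositive on the whole graph.\<close>

lemma zero_in_mordukhovich_derivativeI:
  assumes "\<And>u v. v \<in> F u \<Longrightarrow> blinfun_apply g v \<ge> blinfun_apply g y"
  shows "0 \<in> mordukhovich_derivative F x y g"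
  unfolding mordukhovich_derivative_def mem_Collect_eq
proof (rule Limsup_bounded)
  have "\<forall>\<^sub>F p in at (x, y) within gph F. p \<in> gph F"
    by (simp add: eventually_at_filter)
  then show "\<forall>\<^sub>F p in at (x, y) within gph F. (case p of (u, v) \<Rightarrow>
      ereal ((blinfun_apply 0 (u - x) - blinfun_apply g (v - y)) / (norm (u - x) + norm (v - y)))) \<le> 0"
    by eventually_elim
      (auto simp: gph_def blinfun.diff_right zero_ereal_def intro!: divide_nonpos_nonneg assms)
qed

section \<open>Covering constants\<close>

lemma covering_constant_nonneg: "covering_constant F x y \<ge> 0"
  unfolding covering_constant_def
  by (rule SUP_upper2[of 1]) (auto intro!: Inf_greatest)

text \<open>The base point lies in the balls of every radius, so one derivative there bounds all the
  infima at once.\<close>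

lemma covering_constant_leI:
  assumes "linf_functional z \<in> mordukhovich_derivative F x y (linf_functional w)"
    and "y \<in> F x" "norm w = 1"
  shows "covering_constant F x y \<le> ereal (norm z)"
  unfolding covering_constant_def
proof (rule SUP_least)
  fix \<eta> :: real assume "\<eta> \<in> {0<..}"
  then have "x \<in> cball x \<eta>" "y \<in> F x \<inter> cball y \<eta>" using assms by auto
  with assms show "Inf {ereal (norm z) | (z :: linf) (w :: linf) x' y'.
      linf_functional z \<in> mordukhovich_derivative F x' y' (linf_functional w)
      \<and> x' \<in> cball x \<eta> \<and> y' \<in> F x' \<inter> cball y \<eta> \<and> norm w = 1} \<le> ereal (norm z)"
    by (intro Inf_lower) blast
qed

lemma linf_functional_const: "linf_functional (const_bcontfun c) x = c * (\<Sum>n. l1_seq x n)"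
  by (simp add: linf_functional_apply const_bcontfun.rep_eq suminf_mult mult.commute)

lemma covering_constant_P_ball_eq_0:
  assumes y: "y \<in> P_ball x" and s: "(\<Sum>n. l1_seq y n) \<in> {1, -1}"
  shows "covering_constant P_ball x y = 0"
proof (rule antisym[OF _ covering_constant_nonneg])
  define s where "s = (\<Sum>n. l1_seq y n)"
  \<comment> \<open>As \<open>s * s = 1\<close>, the functional takes at \<open>y\<close> the value
    -1, the least possible on the unit ball.\<close>
  have "linf_functional (const_bcontfun (- s)) v \<ge> linf_functional (const_bcontfun (- s)) y"
    if "v \<in> P_ball u" for u v
  proof -
    have "norm v \<le> 1" using that by (simp add: metric_projection_def)
    then have "\<bar>\<Sum>n. l1_seq v n\<bar> \<le> 1"
      using suminf_l1_le_norm[of v] suminf_l1_le_norm[of "- v"]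
      unfolding suminf_l1_uminus norm_minus_cancel by linarith
    then show ?thesis
      using s by (auto simp: linf_functional_const simp flip: s_def)
  qed
  then have "0 \<in> mordukhovich_derivative P_ball x y (linf_functional (const_bcontfun (- s)))"
    by (rule zero_in_mordukhovich_derivativeI)
  moreover have "linf_functional 0 = 0"
    by (rule blinfun_eqI) (simp add: linf_functional_apply)
  moreover have "norm (const_bcontfun (- s) :: linf) = 1"
    using s by (auto simp: norm_linf_eq const_bcontfun.rep_eq simp flip: s_def)
  ultimately show "covering_constant P_ball x y \<le> 0"
    using covering_constant_leI[of 0 P_ball x y "const_bcontfun (- s)"] y
    by (simp add: zero_ereal_def)
qed

lemma covering_constant_P_ball_eq_1:
  assumes "norm x < 1"
  shows "covering_constant P_ball x x = 1"
proof (rule antisym)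
  \<comment> \<open>The derivative is needed at all points \<open>u\<close> of the open ball,
    because the infimum also runs over points near \<open>x\<close>.\<close>
  have D: "mordukhovich_derivative P_ball u u g = {g}" if "norm u < 1" for u g
  proof (rule mordukhovich_derivative_eventually_id)
    have "\<forall>\<^sub>F v in nhds u. v \<in> ball 0 1"
      using that by (intro eventually_nhds_in_open) auto
    then show "\<forall>\<^sub>F v in nhds u. P_ball v = {v}"
      by eventually_elim (simp add: metric_projection_mem)
  qed
  have P: "P_ball u = {u}" if "norm u < 1" for u
    using that by (simp add: metric_projection_mem)
  have n1: "norm (const_bcontfun 1 :: linf) = 1"
    by (simp add: norm_linf_eq const_bcontfun.rep_eq)
  with covering_constant_leI[of "const_bcontfun 1" P_ball x x "const_bcontfun 1"]
  show "covering_constant P_ball x x \<le> 1"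
    by (simp add: D[OF assms] P[OF assms] one_ereal_def)
  \<comment> \<open>Half the distance to the unit sphere: the closed ball of this radius around
    \<open>x\<close> stays in the open unit ball.\<close>
  define \<eta> where "\<eta> = (1 - norm x) / 2"
  have ball: "norm u < 1" if "u \<in> cball x \<eta>" for u
    using that assms norm_triangle_ineq2[of u x]
    by (simp add: \<eta>_def dist_norm norm_minus_commute field_simps)
  show "1 \<le> covering_constant P_ball x x"
    unfolding covering_constant_def
  proof (rule SUP_upper2[of \<eta>])
    show "\<eta> \<in> {0<..}" using assms by (simp add: \<eta>_def)
    show "1 \<le> Inf {ereal (norm z) | (z :: linf) (w :: linf) u v.
        linf_functional z \<in> mordukhovich_derivative P_ball u v (linf_functional w)
        \<and> u \<in> cball x \<eta> \<and> v \<in> P_ball u \<inter> cball x \<eta> \<and> norm w = 1}"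
    proof (rule Inf_greatest, clarify)
      fix z w :: linf and u v
      assume a: "linf_functional z \<in> mordukhovich_derivative P_ball u v (linf_functional w)"
        and "u \<in> cball x \<eta>" "v \<in> P_ball u" and w: "norm w = 1"
      then have "norm u < 1" "v = u" using ball P by auto
      with a have "linf_functional z = linf_functional w" by (simp add: D)
      then have "norm z = norm w" by (metis norm_linf_functional)
      with w show "1 \<le> ereal (norm z)" by (simp add: one_ereal_def)
    qed
  qed
qed

theorem theorem3p4:
  fixes xbar :: l1
  shows
    "(\<forall>ybar \<in> P_ball xbar.
        norm xbar \<ge> 1 \<and> (\<Sum>n. l1_seq ybar n) \<in> {1, -1}
          \<longrightarrow> covering_constant P_ball xbar ybar = 0)
     \<and> (norm xbar \<ge> 1 \<and> xbar \<in> l1_cone \<union> uminus ` l1_cone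
          \<longrightarrow> (\<forall>ybar \<in> P_ball xbar. covering_constant P_ball xbar ybar = 0))
     \<and> (norm xbar \<ge> 2
          \<longrightarrow> (\<exists>ybar \<in> P_ball xbar. (\<Sum>n. l1_seq ybar n) \<in> {1, -1}
                \<and> covering_constant P_ball xbar ybar = 0))
     \<and> (xbar \<in> interior unit_ball
          \<longrightarrow> P_ball xbar = {xbar} \<and> covering_constant P_ball xbar xbar = 1)"
proof (intro conjI ballI impI)
  fix y assume "y \<in> P_ball xbar" "norm xbar \<ge> 1 \<and> (\<Sum>n. l1_seq y n) \<in> {1, -1}"
  then show "covering_constant P_ball xbar y = 0"
    by (intro covering_constant_P_ball_eq_0) auto
next
  fix y
  assume x: "norm xbar \<ge> 1 \<and> xbar \<in> l1_cone \<union> uminus ` l1_cone" and y: "y \<in> P_ball xbar"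
  have "(\<Sum>n. l1_seq y n) \<in> {1, -1}"
  proof (cases "xbar \<in> l1_cone")
    case True
    with x y show ?thesis by (simp add: suminf_P_ball_cone)
  next
    case False
    with x have "- xbar \<in> l1_cone" "norm (- xbar) \<ge> 1" by auto
    with y suminf_P_ball_cone[of "- xbar" "- y"] show ?thesis
      by (auto simp: P_ball_uminus suminf_l1_uminus simp del: l1_seq_simps)
  qed
  with y show "covering_constant P_ball xbar y = 0"
    by (rule covering_constant_P_ball_eq_0)
next
  assume "norm xbar \<ge> 2"
  \<comment> \<open>The positive and negative parts have norms adding up to at least 2, so one of
    them has norm at least 1.\<close>
  then consider "norm (l1_pos_part xbar) \<ge> 1" | "norm (l1_pos_part (- xbar)) \<ge> 1"
    using norm_l1_pos_part_add[of xbar] by linarith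
  then obtain y where "y \<in> P_ball xbar" "(\<Sum>n. l1_seq y n) \<in> {1, -1}"
  proof cases
    case 1
    then show ?thesis by (rule P_ball_suminf_1) (rule that, auto)
  next
    case 2
    then obtain y where "y \<in> P_ball (- xbar)" "(\<Sum>n. l1_seq y n) = 1"
      by (rule P_ball_suminf_1)
    then show ?thesis
      using that[of "- y"] P_ball_uminus[of "- y" xbar]
      by (simp add: suminf_l1_uminus del: l1_seq_simps)
  qed
  then show "\<exists>ybar \<in> P_ball xbar. (\<Sum>n. l1_seq ybar n) \<in> {1, -1}
      \<and> covering_constant P_ball xbar ybar = 0"
    using covering_constant_P_ball_eq_0 by blast
next
  assume "xbar \<in> interior unit_ball"
  then have x: "norm xbar < 1" by (rule interior_unit_ball_norm_less)
  then show "P_ball xbar = {xbar}" by (simp add: metric_projection_mem)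
  from x show "covering_constant P_ball xbar xbar = 1" by (rule covering_constant_P_ball_eq_1)
qed

end
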